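(* Let $m \ge 0$ be an integer. With the notation of the context, the generating function $G_{m,0,m,0}(1,1;t)$, which counts walks starting and ending at $(m,0)$ in the lattice $\mathcal{L}_m$, is given by \[ G_{m,0,m,0}(1,1;t) = 1-\frac{x^{m+1}+y\,G_{m,0}(x,y;t)}{G_{m+1,0}(x,y;t)}. \]
   Context: For an integer $n \ge 0$ let $\mathcal{L}_n = \{(i,j) \in \mathbb{Z}_{\ge 0}^2 : i+j = n\}$ (the "simplified linear lattice", a one-dimensional simplex, i.e. a path graph on $n+1$ points). A walk of length $k$ in $\mathcal{L}_n$ is a sequence of points $p_0, p_1, \dots, p_k$ of $\mathcal{L}_n$ such that each step $p_{r}-p_{r-1}$ is $(1,-1)$ or $(-1,1)$. For $(u,v)$ with $u,v\ge 0$, $G_{u,v}(x,y;t)$ denotes the generating function of all walks in $\mathcal{L}_{u+v}$ starting at $(u,v)$ (ending anywhere), where a walk of length $k$ ending at $(i,j)$ has weight $x^i y^j t^k$; so $x,y$ record the endpoint and $t$ records the number of steps. For points $(u,v),(u',v')$ with $u+v=u'+v'$, $G_{u,v,u',v'}(1,1;t)$ denotes the generating function $\sum_k c_k t^k$ where $c_k$ is the number of walks of length $k$ in $\mathcal{L}_{u+v}$ starting at $(u,v)$ and ending at $(u',v')$.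
   Formalization: The printed formula is false for every m (at t=0 its sides are 1 and -y/x). The formal statement restores the step weights: G_{m,0,m,0} = (1 - (x^{m+1} + t y G_{m,0})/G_{m+1,0})/t^2. *)

theory Defs
  imports "HOL-Computational_Algebra.Computational_Algebra"
begin

definition lattice :: "nat \<Rightarrow> (nat \<times> nat) set" where
  "lattice n = {(i, j). i + j = n}"

definition is_step :: "nat \<times> nat \<Rightarrow> nat \<times> nat \<Rightarrow> bool" where
  "is_step p q \<longleftrightarrow>
     (int (fst q) - int (fst p), int (snd q) - int (snd p)) \<in> {(1, -1), (-1, 1)}"

(* A walk of length k is the list of its k + 1 points. *)

definition walks_from :: "nat \<Rightarrow> nat \<times> nat \<Rightarrow> nat \<Rightarrow> (nat \<times> nat) list set" where
  "walks_from n p k =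
     {ps. length ps = Suc k \<and> set ps \<subseteq> lattice n \<and> hd ps = p \<and>
          (\<forall>r<k. is_step (ps ! r) (ps ! Suc r))}"

lemma finite_lattice: "finite (lattice n)"
  by (rule finite_subset[of _ "{..n} \<times> {..n}"]) (auto simp: lattice_def)

lemma finite_walks_from: "finite (walks_from n p k)"
  by (rule finite_subset[OF _ finite_lists_length_eq[OF finite_lattice, of n "Suc k"]])
     (auto simp: walks_from_def)

(* The generating functions live in Z[x,y][[t]], rendered as int poly poly fps:
   x is the variable of the inner polynomials, y that of the outer ones, and t = fps_X. *)

definition X :: "int poly poly" where "X = [:[:0, 1:]:]"

definition Y :: "int poly poly" where "Y = [:0, 1:]"

definition GF :: "nat \<Rightarrow> nat \<Rightarrow> int poly poly fps" where
  "GF u v = Abs_fps (\<lambda>k.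
     \<Sum>ps\<in>walks_from (u + v) (u, v) k. X ^ fst (last ps) * Y ^ snd (last ps))"

definition GF_between :: "nat \<Rightarrow> nat \<Rightarrow> nat \<Rightarrow> nat \<Rightarrow> int poly poly fps" where
  "GF_between u v u' v' = Abs_fps (\<lambda>k.
     of_nat (card {ps \<in> walks_from (u + v) (u, v) k. last ps = (u', v')}))"

(* GF (m + 1) 0 has constant term x^(m+1), so it is nonzero but not a unit of Z[x,y][[t]];
   quotients are therefore taken in the fraction field of Z[x,y][[t]], where the indeterminates
   are denoted as follows. *)

abbreviation x_ind :: "int poly poly fps fract" where "x_ind \<equiv> to_fract (fps_const X)"

abbreviation y_ind :: "int poly poly fps fract" where "y_ind \<equiv> to_fract (fps_const Y)"

abbreviation t_ind :: "int poly poly fps fract" where "t_ind \<equiv> to_fract fps_X"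

(* Since t marks every step, the first-return decomposition reads
     GF (m+1) 0 = x^(m+1) + t y GF m 0 + t^2 GF_between m 0 m 0 * GF (m+1) 0,
   the factors t and t^2 counting the steps between (m+1,0) and (m,1).  The formula is sometimes
   printed without these factors; that version fails for every m, as its two sides have the
   constant terms 1 and -y/x in t. *)

end

theory Submission
  imports Defs
begin

text \<open>
  A walk from \<open>(m + 1, 0)\<close> is empty, or steps to \<open>(m, 1)\<close> and then either stays in the copy
  of the smaller lattice formed by the points \<open>(i, j + 1)\<close> or leaves it for the first time by
  stepping from \<open>(m, 1)\<close> to \<open>(m + 1, 0)\<close>.  For arbitrary starting points \<open>(i, j + 1)\<close> this
  first-passage decomposition is an identity between solutions of the one-step recursion, so
  induction on the length proves it without cutting walks into pieces.
\<close>

text \<open>The end weight \<open>w\<close> is kept arbitrary so that one recursion serves both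
  generating functions: monomials give the coefficients of \<open>GF\<close>, the indicator of a
  point those of \<open>GF_between\<close>.\<close>

definition walk_sum :: "nat \<Rightarrow> (nat \<times> nat \<Rightarrow> 'a::comm_monoid_add) \<Rightarrow> nat \<times> nat \<Rightarrow> nat \<Rightarrow> 'a" where
  "walk_sum n w p k = (\<Sum>ps\<in>walks_from n p k. w (last ps))"

lemma walks_from_0:
  assumes "p \<in> lattice n"
  shows "walks_from n p 0 = {[p]}"
  using assms by (auto simp: walks_from_def length_Suc_conv)

lemma walks_from_Suc:
  assumes "p \<in> lattice n"
  shows "walks_from n p (Suc k) = (\<Union>q\<in>{q \<in> lattice n. is_step p q}. (#) p ` walks_from n q k)"
    (is "?L = ?R")
proof
  show "?L \<subseteq> ?R"
  proof
    fix ps assume "ps \<in> ?L"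
    then have len: "length ps = Suc (Suc k)" and sub: "set ps \<subseteq> lattice n" and hd: "hd ps = p"
      and st: "\<And>r. r < Suc k \<Longrightarrow> is_step (ps ! r) (ps ! Suc r)"
      by (auto simp: walks_from_def)
    obtain q qs where ps: "ps = p # q # qs"
      using len hd by (auto simp: length_Suc_conv)
    have "is_step p q" using st[of 0] ps by simp
    moreover have "\<forall>r<k. is_step ((q # qs) ! r) ((q # qs) ! Suc r)"
      using st[of "Suc r" for r] ps by simp
    ultimately have "q # qs \<in> walks_from n q k"
      using len sub ps by (simp add: walks_from_def)
    moreover have "q \<in> lattice n" using sub ps by simp
    ultimately show "ps \<in> ?R"
      using \<open>is_step p q\<close> ps by blast
  qed
  show "?R \<subseteq> ?L"
  proof
    fix ps assume "ps \<in> ?R"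
    then obtain q qs where q: "q \<in> lattice n" "is_step p q" "qs \<in> walks_from n q k" "ps = p # qs"
      by blast
    then have "qs ! 0 = q" by (cases qs) (auto simp: walks_from_def)
    then have "is_step (ps ! r) (ps ! Suc r)" if "r < Suc k" for r
      using q that by (cases r) (auto simp: walks_from_def)
    then show "ps \<in> ?L"
      using q assms by (auto simp: walks_from_def)
  qed
qed

lemma walk_sum_0: "p \<in> lattice n \<Longrightarrow> walk_sum n w p 0 = w p"
  by (simp add: walk_sum_def walks_from_0)

lemma walk_sum_Suc:
  assumes "p \<in> lattice n"
  shows "walk_sum n w p (Suc k) = (\<Sum>q\<in>{q \<in> lattice n. is_step p q}. walk_sum n w q k)"
proof -
  let ?N = "{q \<in> lattice n. is_step p q}"
  have "walk_sum n w p (Suc k) = (\<Sum>q\<in>?N. \<Sum>ps\<in>(#) p ` walks_from n q k. w (last ps))"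
    unfolding walk_sum_def walks_from_Suc[OF assms]
  proof (rule sum.UNION_disjoint)
    \<comment> \<open>The tail of such a walk begins at \<open>q\<close>, so the walk determines
      \<open>q\<close>.\<close>
    show "\<forall>q\<in>?N. \<forall>q'\<in>?N. q \<noteq> q' \<longrightarrow>
        (#) p ` walks_from n q k \<inter> (#) p ` walks_from n q' k = {}"
      by (auto simp: walks_from_def)
  qed (auto simp: finite_lattice finite_walks_from)
  also have "\<dots> = (\<Sum>q\<in>?N. walk_sum n w q k)"
  proof (rule sum.cong[OF refl])
    fix q
    have "(\<Sum>ps\<in>(#) p ` walks_from n q k. w (last ps))
        = (\<Sum>ps\<in>walks_from n q k. w (last (p # ps)))"
      by (subst sum.reindex) auto
    also have "\<dots> = walk_sum n w q k"
      unfolding walk_sum_def by (rule sum.cong) (auto simp: walks_from_def)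
    finally show "(\<Sum>ps\<in>(#) p ` walks_from n q k. w (last ps)) = walk_sum n w q k" .
  qed
  finally show ?thesis .
qed

lemma lattice_neighbours:
  assumes "i + j = n"
  shows "{q \<in> lattice n. is_step (i, j) q} =
    (if i = 0 then {} else {(i - 1, Suc j)}) \<union> (if j = 0 then {} else {(Suc i, j - 1)})"
  using assms by (auto simp: lattice_def is_step_def)

lemma walk_sum_step:
  assumes "i + j = n"
  shows "walk_sum n w (i, j) (Suc k) =
    (if i = 0 then 0 else walk_sum n w (i - 1, Suc j) k) +
    (if j = 0 then 0 else walk_sum n w (Suc i, j - 1) k)"
proof -
  have "(i, j) \<in> lattice n" using assms by (simp add: lattice_def)
  then show ?thesis
    by (simp add: walk_sum_Suc lattice_neighbours[OF assms] add.commute)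
qed

text \<open>Raising the second coordinate by one embeds the lattice of \<open>m\<close> into that of
  \<open>Suc m\<close> and costs a factor \<open>c\<close> in weight. The first summand collects
  walks that stay in this copy. In the other, \<open>r\<close> steps inside the copy lead to its end
  \<open>(m, 1)\<close>, one step leaves to \<open>(Suc m, 0)\<close>, and \<open>k - Suc r\<close>
  steps remain unrestricted.\<close>

lemma walk_sum_first_passage:
  fixes w w' :: "nat \<times> nat \<Rightarrow> 'a::comm_semiring_1"
  assumes shift: "\<And>i j. w' (i, Suc j) = c * w (i, j)"
    and "i + j = m"
  shows "walk_sum (Suc m) w' (i, Suc j) k = c * walk_sum m w (i, j) k +
    (\<Sum>r<k. walk_sum m (\<lambda>p. of_bool (p = (m, 0))) (i, j) r *
      walk_sum (Suc m) w' (Suc m, 0) (k - Suc r))"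
  using assms(2)
proof (induction k arbitrary: i j)
  case 0
  then show ?case by (simp add: walk_sum_0 lattice_def shift)
next
  case (Suc k)
  let ?E = "walk_sum m (\<lambda>p. of_bool (p = (m, 0)) :: 'a)"
  let ?F = "\<lambda>k. walk_sum (Suc m) w' (Suc m, 0) k"
  have E0: "?E (i, j) 0 = of_bool (j = 0)"
    using Suc.prems by (subst walk_sum_0) (auto simp: lattice_def)
  \<comment> \<open>The term \<open>r = 0\<close> is an immediate exit, possible only from
    \<open>j = 0\<close>; in the other terms the first step stays in the copy.\<close>
  have split: "(\<Sum>r<Suc k. ?E (i, j) r * ?F (Suc k - Suc r)) =
      of_bool (j = 0) * ?F k + (\<Sum>r<k. ?E (i, j) (Suc r) * ?F (k - Suc r))"
    by (subst sum.lessThan_Suc_shift) (simp add: E0)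
  have left: "walk_sum (Suc m) w' (i - 1, Suc (Suc j)) k = c * walk_sum m w (i - 1, Suc j) k +
      (\<Sum>r<k. ?E (i - 1, Suc j) r * ?F (k - Suc r))" if "i \<noteq> 0"
    using Suc.IH[of "i - 1" "Suc j"] Suc.prems that by simp
  have right: "walk_sum (Suc m) w' (Suc i, j) k = c * walk_sum m w (Suc i, j - 1) k +
      (\<Sum>r<k. ?E (Suc i, j - 1) r * ?F (k - Suc r))" if "j \<noteq> 0"
    using Suc.IH[of "Suc i" "j - 1"] Suc.prems that by simp
  \<comment> \<open>In the larger lattice the step lowering \<open>Suc j\<close> always exists. For
    \<open>j = 0\<close> it is the exit to \<open>(Suc m, 0)\<close> and matches the term
    \<open>r = 0\<close> above; otherwise \<open>right\<close> applies.\<close>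
  have L: "walk_sum (Suc m) w' (i, Suc j) (Suc k) =
      (if i = 0 then 0 else walk_sum (Suc m) w' (i - 1, Suc (Suc j)) k) +
      walk_sum (Suc m) w' (Suc i, j) k"
    using Suc.prems by (subst walk_sum_step) auto
  show ?case
    unfolding split L walk_sum_step[OF Suc.prems]
    using left right Suc.prems
    by (cases "i = 0"; cases "j = 0") (simp_all add: algebra_simps sum.distrib)
qed

lemma GF_nth: "fps_nth (GF u v) k = walk_sum (u + v) (\<lambda>p. X ^ fst p * Y ^ snd p) (u, v) k"
  by (simp add: GF_def walk_sum_def)

lemma GF_between_nth:
  "fps_nth (GF_between u v u' v') k = walk_sum (u + v) (\<lambda>p. of_bool (p = (u', v'))) (u, v) k"
  by (simp add: GF_between_def walk_sum_def finite_walks_from Int_def)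

text \<open>From the corner \<open>(Suc m, 0)\<close> the first step is forced to
  \<open>(m, 1)\<close>, where the first-passage identity applies with \<open>c = Y\<close>.\<close>

lemma GF_first_return:
  "GF (Suc m) 0 = fps_const X ^ Suc m + fps_X * fps_const Y * GF m 0 +
    fps_X ^ 2 * GF_between m 0 m 0 * GF (Suc m) 0"
proof (rule fps_ext)
  fix k
  let ?B = "GF_between m 0 m 0 * GF (Suc m) 0"
  \<comment> \<open>An outer factor \<open>fps_X\<close> is exposed for the forced first step; the
    inner one left before \<open>?B\<close> stands for the exit step.\<close>
  have rhs: "fps_X * fps_const Y * GF m 0 = fps_X * (fps_const Y * GF m 0)"
    "fps_X ^ 2 * GF_between m 0 m 0 * GF (Suc m) 0 = fps_X * (fps_X * ?B)"
    by (simp_all add: power2_eq_square mult.assoc)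
  show "fps_nth (GF (Suc m) 0) k = fps_nth (fps_const X ^ Suc m + fps_X * fps_const Y * GF m 0 +
      fps_X ^ 2 * GF_between m 0 m 0 * GF (Suc m) 0) k"
  proof (cases k)
    case 0
    then show ?thesis
      unfolding rhs by (simp add: GF_nth walk_sum_0 lattice_def)
  next
    case (Suc l)
    have "fps_nth (GF (Suc m) 0) k = walk_sum (Suc m) (\<lambda>p. X ^ fst p * Y ^ snd p) (m, Suc 0) l"
      using Suc by (simp add: GF_nth walk_sum_step)
    also have "\<dots> = Y * fps_nth (GF m 0) l +
        (\<Sum>r<l. fps_nth (GF_between m 0 m 0) r * fps_nth (GF (Suc m) 0) (l - Suc r))"
      by (subst walk_sum_first_passage[where w = "\<lambda>p. X ^ fst p * Y ^ snd p" and c = Y])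
        (simp_all add: GF_nth GF_between_nth mult_ac)
    also have "(\<Sum>r<l. fps_nth (GF_between m 0 m 0) r * fps_nth (GF (Suc m) 0) (l - Suc r)) =
        fps_nth (fps_X * ?B) l"
    \<comment> \<open>For \<open>l = 0\<close> there is no room for an exit and both sides vanish.
      For \<open>l = Suc l'\<close> the index \<open>l - Suc r\<close> is \<open>l' - r\<close>, so
      the sum is a Cauchy product coefficient.\<close>
    proof (cases l)
      case (Suc l')
      then have "fps_nth (fps_X * ?B) l = fps_nth ?B l'" by simp
      then show ?thesis
        using Suc by (simp add: fps_mult_nth[of "GF_between m 0 m 0"] lessThan_Suc_atMost atMost_atLeast0)
    qed simp
    finally show ?thesis
      unfolding rhs using Suc by (simp add: fps_const_power)
  qed
qed

lemma GF_nonzero: "GF (Suc m) 0 \<noteq> 0"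
proof
  assume "GF (Suc m) 0 = 0"
  then have "fps_nth (GF (Suc m) 0) 0 = 0" by simp
  then show False by (simp add: GF_nth walk_sum_0 lattice_def X_def)
qed

theorem theorem2:
  fixes m :: nat
  shows "to_fract (GF_between m 0 m 0) =
    (1 - (x_ind ^ (m + 1) + t_ind * y_ind * to_fract (GF m 0)) / to_fract (GF (m + 1) 0))
      / t_ind ^ 2"
proof -
  have pow: "to_fract (a ^ n) = to_fract a ^ n" for a :: "int poly poly fps" and n
    by (induction n) simp_all
  \<comment> \<open>In the fraction field this equation is linear in the unknown
    \<open>GF_between m 0 m 0\<close>, with nonzero coefficient.\<close>
  have "to_fract (GF (m + 1) 0) = x_ind ^ (m + 1) + t_ind * y_ind * to_fract (GF m 0) +
      t_ind ^ 2 * to_fract (GF_between m 0 m 0) * to_fract (GF (m + 1) 0)"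
    using arg_cong[OF GF_first_return[of m], of to_fract]
    by (simp only: to_fract_add to_fract_mult pow Suc_eq_plus1)
  moreover have "to_fract (GF (m + 1) 0) \<noteq> 0"
    using GF_nonzero[of m] by simp
  moreover have "t_ind \<noteq> 0" by simp
  ultimately show ?thesis
    by (simp add: field_simps)
qed

end
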